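(* Let $r\ge 1$ be an integer, and let $$T(z)=-\tfrac{3}{2}\sqrt{3}\,\bigl(i+\sqrt{3}-2iz\bigr)(z-1)z,\qquad S_r(z)=(1-z)^r\sum_{j=0}^{r-1}\binom{r-1+j}{r-1}z^j .$$ Then $F(z)=(T\circ S_r)(z)=T(S_r(z))$ is a Shabat polynomial whose associated tree has passport $[r^2,1^{4r-3};3^{2r-1}]$, with two black vertices of degree $r$ located at $z=0$ and $z=1$. Moreover $F$ is unique up to isomorphism: every Shabat polynomial whose tree has passport $[r^2,1^{4r-3};3^{2r-1}]$ is isomorphic to $F$.
   Context: A Shabat polynomial is a nonconstant polynomial $F:\mathbb{C}\to\mathbb{C}$ all of whose critical values lie in $\{0,1\}$. Its associated tree (dessin) is the bicolored plane tree $F^{-1}([0,1])$, with black vertices $F^{-1}(0)$, white vertices $F^{-1}(1)$, and edges the connected components of $F^{-1}((0,1))$; the degree of a black (resp. white) vertex is the multiplicity of the corresponding root of $F$ (resp. $F-1$). The passport of the tree is the pair of lists $[b_1,\dots,b_k;w_1,\dots,w_\ell]$ of degrees of the black vertices and of the white vertices (each list taken as a multiset); within a list, $a^m$ denotes $m$ vertices of degree $a$. Two Shabat polynomials $F,G$ are isomorphic if there exist $\alpha,\beta\in\mathbb{C}$ with $F(z)=G(\alpha z+\beta)$. Here $i=\sqrt{-1}$. *)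

theory Defs
  imports
    "HOL-Analysis.Analysis"
    "HOL-Computational_Algebra.Polynomial"
    "HOL-Library.Multiset"
begin

definition shabat :: "complex poly \<Rightarrow> bool" where
  "shabat F \<longleftrightarrow> degree F > 0 \<and> (\<forall>z. poly (pderiv F) z = 0 \<longrightarrow> poly F z \<in> {0, 1})"

definition shabat_isomorphic :: "complex poly \<Rightarrow> complex poly \<Rightarrow> bool" where
  "shabat_isomorphic F G \<longleftrightarrow> (\<exists>\<alpha> \<beta>. \<forall>z. poly F z = poly G (\<alpha> * z + \<beta>))"

text \<open>The data of a bicolored tree drawn in the complex plane; being a tree is not part of the type,
  it is a fact about \<open>F -` [0,1]\<close> for the polynomials below. Edges are open arcs, given as point sets; the two degree functions are meaningful on the black, respectively white, vertices only.\<close>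

record plane_tree =
  support :: "complex set"
  black_vertices :: "complex set"
  white_vertices :: "complex set"
  tree_edges :: "complex set set"
  black_degree :: "complex \<Rightarrow> nat"
  white_degree :: "complex \<Rightarrow> nat"

definition shabat_tree :: "complex poly \<Rightarrow> plane_tree" where
  "shabat_tree F = \<lparr>
     support = poly F -` complex_of_real ` {0..1},
     black_vertices = {z. poly F z = 0},
     white_vertices = {z. poly F z = 1},
     tree_edges = components (poly F -` complex_of_real ` {0<..<1}),
     black_degree = (\<lambda>z. order z F),
     white_degree = (\<lambda>z. order z (F - 1))\<rparr>"

text \<open>Black degrees first, white degrees second. The vertex sets of the tree of a nonconstant
  polynomial are finite, so \<^const>\<open>mset_set\<close> loses nothing there.\<close>

definition passport :: "plane_tree \<Rightarrow> nat multiset \<times> nat multiset" where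
  "passport D =
     (image_mset (black_degree D) (mset_set (black_vertices D)),
      image_mset (white_degree D) (mset_set (white_vertices D)))"

definition T_poly :: "complex poly" where
  "T_poly = smult (- (3 / 2) * complex_of_real (sqrt 3))
     ([:\<i> + complex_of_real (sqrt 3), - 2 * \<i>:] * [:- 1, 1:] * [:0, 1:])"

text \<open>Meant for \<open>r \<ge> 1\<close>, where the truncated \<open>r - 1\<close> is the usual one.\<close>

definition S_poly :: "nat \<Rightarrow> complex poly" where
  "S_poly r = [:1, - 1:] ^ r *
     (\<Sum>j=0..r-1. monom (of_nat ((r - 1 + j) choose (r - 1))) j)"

end

theory Submission
  imports Defs "HOL-Computational_Algebra.Fundamental_Theorem_Algebra"
begin

text \<open>
  Put \<open>n = r - 1\<close> and \<open>S = S_poly r\<close>. Everything follows from two closed forms. The polynomial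
  \<open>T_poly\<close> vanishes at the corners of an equilateral triangle two of whose corners are \<open>0\<close> and
  \<open>1\<close>; if \<open>w\<close> denotes the centre of that triangle, then \<open>T_poly = 1 + K (z - w)\<^sup>3\<close> with
  \<open>K w\<^sup>3 = 1\<close> (lemma \<open>poly_T_poly\<close>). The polynomial \<open>S\<close> satisfies \<open>S(0) = 1\<close>, \<open>S(1) = 0\<close>, and its
  derivative is a nonzero multiple of \<open>z\<^sup>n (z - 1)\<^sup>n\<close> (lemma \<open>pderiv_S_poly\<close>).

  Existence. We have \<open>F = 1 + K (S - w)\<^sup>3\<close>, so \<open>F' = 3 K (S - w)\<^sup>2 S'\<close>: a critical point of \<open>F\<close>
  is a root of \<open>S - w\<close>, where \<open>F = 1\<close>, or one of \<open>0\<close> and \<open>1\<close>, where \<open>F = 0\<close>. The multiplicity of a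
  root of \<open>F\<close> or \<open>F - 1\<close> exceeds its multiplicity as a root of \<open>F'\<close> by one, which gives all the
  degrees; the number of vertices follows since the multiplicities sum to \<open>deg F = 6 r - 3\<close>.

  Uniqueness. If \<open>G\<close> has the given passport, then all roots of \<open>G - 1\<close> are triple, so
  \<open>G = 1 + c P\<^sup>3\<close> with \<open>deg P = 2 r - 1\<close> (lemma \<open>passport_shape\<close>). At two distinct black
  vertices \<open>a\<close>, \<open>b\<close> of degree \<open>r\<close> the derivative \<open>P'\<close> vanishes to order \<open>n\<close>; since
  \<open>deg P' = 2 n\<close>, it is a multiple of \<open>(z - a)\<^sup>n (z - b)\<^sup>n\<close>. Up to a constant factor and the affine
  substitution that takes \<open>0, 1\<close> to \<open>a, b\<close> this is the derivative of \<open>S\<close>, whence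
  \<open>P(a + (b - a) z) = (u - v) S(z) + v\<close> for \<open>u = P(a)\<close> and \<open>v = P(b)\<close> (lemma \<open>affine_S_poly\<close>).
  Here \<open>u \<noteq> v\<close>, because \<open>P\<close> is not constant, and \<open>c u\<^sup>3 = c v\<^sup>3 = - 1\<close>. Hence \<open>u / v\<close> is one of
  the two primitive cube roots of unity; exchanging \<open>a\<close> and \<open>b\<close> inverts it, and for one of the two
  orderings \<open>G(a + (b - a) z)\<close> is exactly \<open>F(z)\<close> (lemmas \<open>equal_cubes_cases\<close> and
  \<open>isomorphic_if_oriented\<close>).
\<close>

section \<open>Multiplicities of complex polynomials\<close>

lemma sum_order_eq_degree:
  fixes p :: "complex poly"
  assumes "p \<noteq> 0"
  shows "(\<Sum>z | poly p z = 0. order z p) = degree p"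
proof -
  have "(\<Sum>z | poly p z = 0. order z p) = size (proots p)"
    using assms by (simp add: size_multiset_overloaded_eq)
  then show ?thesis by (simp add: size_proots_complex)
qed

lemma order_linear_power_other:
  fixes a z :: complex
  assumes "z \<noteq> a"
  shows "order z ([:- a, 1:] ^ n) = 0"
  using assms by (intro order_0I) auto

lemma order_linear_powers:
  fixes a b z :: complex
  assumes "a \<noteq> b"
  shows "order z ([:- a, 1:] ^ n * [:- b, 1:] ^ n) = (if z \<in> {a, b} then n else 0)"
proof -
  have "order z ([:- a, 1:] ^ n * [:- b, 1:] ^ n)
      = order z ([:- a, 1:] ^ n) + order z ([:- b, 1:] ^ n)"
    by (intro order_mult) simp
  then show ?thesis
    using assms by (auto simp: order_power_n_n order_linear_power_other)
qed

lemma order_power: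
  fixes p :: "complex poly"
  assumes "p \<noteq> 0"
  shows "order z (p ^ n) = n * order z p"
proof -
  have "count (proots (p ^ n)) z = n * count (proots p) z"
    by (simp add: proots_power)
  then show ?thesis using assms by simp
qed

lemma linear_powers_dvd:
  fixes a b :: complex
  assumes "a \<noteq> b" "p \<noteq> 0" "n \<le> order a p" "n \<le> order b p"
  shows "[:- a, 1:] ^ n * [:- b, 1:] ^ n dvd p"
proof -
  have "[:- a, 1:] ^ n dvd p"
    using assms by (simp add: order_divides)
  then obtain q where q: "p = [:- a, 1:] ^ n * q" by (elim dvdE)
  have "order b p = order b ([:- a, 1:] ^ n) + order b q"
    unfolding q using assms(2) q by (intro order_mult) simp
  then have "n \<le> order b q"
    using assms by (simp add: order_linear_power_other)
  then have "[:- b, 1:] ^ n dvd q" by (simp add: order_divides)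
  then show ?thesis unfolding q by (rule mult_dvd_mono[OF dvd_refl])
qed

text \<open>A bound on the degree of the derivative turns two high-order zeros into its full
  factorization.\<close>

lemma pderiv_eq_linear_powers:
  fixes a b :: complex
  assumes "a \<noteq> b" and deg: "degree p = 2 * n + 1"
    and ord: "order a (pderiv p) = n" "order b (pderiv p) = n"
  obtains k where "k \<noteq> 0" "pderiv p = smult k ([:- a, 1:] ^ n * [:- b, 1:] ^ n)"
proof -
  let ?m = "[:- a, 1:] ^ n * [:- b, 1:] ^ n"
  have nz: "pderiv p \<noteq> 0" using deg by (simp add: pderiv_eq_0_iff)
  have "?m dvd pderiv p"
    using assms nz by (intro linear_powers_dvd) auto
  then obtain q where q: "pderiv p = ?m * q" by (elim dvdE)
  then have "q \<noteq> 0" using nz by auto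
  have "degree (pderiv p) = degree ?m + degree q"
    unfolding q using \<open>q \<noteq> 0\<close> by (intro degree_mult_eq) auto
  moreover have "degree ?m = 2 * n"
    by (subst degree_mult_eq) (auto simp: degree_linear_power)
  ultimately have "degree q = 0" using deg by (simp add: degree_pderiv)
  then obtain k where "q = [:k:]" by (rule degree_eq_zeroE)
  with \<open>q \<noteq> 0\<close> q show thesis by (intro that[of k]) (auto simp: mult.commute)
qed

section \<open>Passports\<close>

lemma passport_shabat_tree:
  "passport (shabat_tree F) =
     (image_mset (\<lambda>z. order z F) (mset_set {z. poly F z = 0}),
      image_mset (\<lambda>z. order z (F - 1)) (mset_set {z. poly F z = 1}))"
  by (simp add: passport_def shabat_tree_def)

lemma image_mset_const_on:
  assumes "\<And>z. z \<in> A \<Longrightarrow> f z = k"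
  shows "image_mset f (mset_set A) = replicate_mset (card A) k"
proof (cases "finite A")
  case True
  have "image_mset f (mset_set A) = image_mset (\<lambda>_. k) (mset_set A)"
    using assms True by (intro image_mset_cong) auto
  then show ?thesis by (simp add: image_mset_const_eq)
qed simp

lemma count_image_mset_set:
  assumes "finite A"
  shows "count (image_mset f (mset_set A)) k = card {z \<in> A. f z = k}"
proof -
  have "f -` {k} \<inter> A = {z \<in> A. f z = k}" by auto
  then show ?thesis using assms by (simp add: count_image_mset)
qed

lemma two_elements_if_card_ge_2:
  assumes "card A \<ge> 2"
  obtains a b where "a \<in> A" "b \<in> A" "a \<noteq> b"
proof -
  obtain B where "B \<subseteq> A" "card B = 2"
    using assms obtain_subset_with_card_n by metis
  then show thesis using that by (auto simp: card_2_iff)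
qed

section \<open>The inner polynomial\<close>

lemma poly_S_poly_0 [simp]: "poly (S_poly r) 0 = 1"
  by (simp add: S_poly_def poly_sum poly_monom power_0_left if_distrib sum.delta cong: if_cong)

lemma poly_S_poly_1 [simp]: "r \<ge> 1 \<Longrightarrow> poly (S_poly r) 1 = 0"
  by (simp add: S_poly_def)

text \<open>With \<open>B\<close> the sum in the definition of \<open>S_poly\<close>, the product rule leaves the factor
  \<open>(1 - z) B' - (n + 1) B\<close>, in which all coefficients below the top one cancel.\<close>

lemma pderiv_S_poly:
  obtains C where "C \<noteq> 0"
    "pderiv (S_poly (Suc n)) = smult C ([:0, 1:] ^ n * [:- 1, 1:] ^ n)"
proof -
  define B :: "complex poly" where "B = (\<Sum>j=0..n. monom (of_nat ((n + j) choose n)) j)"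
  have coeff_B: "coeff B j = (if j \<le> n then of_nat ((n + j) choose n) else 0)" for j
    by (auto simp: B_def coeff_sum if_distrib sum.delta cong: if_cong)
  have binom: "Suc j * ((n + Suc j) choose n) = (n + j + 1) * ((n + j) choose n)" for j
    using Suc_times_binomial_add[of n j] Suc_times_binomial_eq[of "n + j" j]
      binomial_symmetric[of n "n + j"] binomial_symmetric[of n "n + Suc j"]
    by (simp add: ac_simps)
  define D :: complex where "D = of_nat ((2 * n + 1) * ((2 * n) choose n))"
  have "[:1, - 1:] * pderiv B - smult (of_nat (Suc n)) B = monom (- D) n"
  proof (rule poly_eqI)
    fix j
    have "coeff ([:1, - 1:] * pderiv B - smult (of_nat (Suc n)) B) j =
        of_nat (Suc j) * coeff B (Suc j) - of_nat (n + j + 1) * coeff B j"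
      by (cases j) (simp_all add: coeff_pderiv algebra_simps)
    also have "\<dots> = coeff (monom (- D) n) j"
    proof (cases "j < n")
      case True
      then show ?thesis
        unfolding coeff_B of_nat_mult[symmetric] if_P[OF less_imp_le[OF True]]
          if_P[OF Suc_leI[OF True]] binom by simp
    next
      case False
      then consider "j = n" | "j > n" by linarith
      then show ?thesis
      proof cases
        case 1
        have "coeff B n = of_nat ((2 * n) choose n)" "coeff B (Suc n) = 0"
          unfolding coeff_B mult_2 by simp_all
        moreover have "n + n + 1 = 2 * n + 1" by simp
        ultimately show ?thesis
          unfolding 1 D_def of_nat_mult by (simp only: coeff_monom) simp
      next
        case 2
        then show ?thesis by (simp add: coeff_B)
      qed
    qed
    finally show "coeff ([:1, - 1:] * pderiv B - smult (of_nat (Suc n)) B) j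
        = coeff (monom (- D) n) j" .
  qed
  moreover have "pderiv (S_poly (Suc n)) =
      [:1, - 1:] ^ n * ([:1, - 1:] * pderiv B - smult (of_nat (Suc n)) B)"
  proof -
    have "S_poly (Suc n) = [:1, - 1:] ^ Suc n * B"
      by (simp add: S_poly_def B_def)
    moreover have "pderiv ([:1, - 1:] :: complex poly) = - 1"
      by (simp add: pderiv_pCons one_pCons)
    ultimately have "pderiv (S_poly (Suc n)) =
        [:1, - 1:] ^ Suc n * pderiv B + B * (smult (of_nat (Suc n)) ([:1, - 1:] ^ n) * - 1)"
      by (simp only: pderiv_mult pderiv_power_Suc)
    also have "\<dots> = [:1, - 1:] ^ n * ([:1, - 1:] * pderiv B - smult (of_nat (Suc n)) B)"
    proof -
      have "(l * q) * p + B * (smult k q * - 1) = q * (l * p - smult k B)"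
        for l q p :: "complex poly" and k
        by (simp add: algebra_simps)
      then show ?thesis by (simp only: power_Suc)
    qed
    finally show ?thesis .
  qed
  moreover have "[:1, - 1:] ^ n = smult ((- 1) ^ n) ([:- 1, 1:] ^ n :: complex poly)"
    by (simp flip: smult_power)
  ultimately have "pderiv (S_poly (Suc n)) =
      smult (- ((- 1) ^ n * D)) ([:0, 1:] ^ n * [:- 1, 1:] ^ n)"
    by (simp add: monom_altdef mult.commute)
  moreover have "D \<noteq> 0" unfolding D_def of_nat_eq_0_iff by simp
  ultimately show thesis using that[of "- ((- 1) ^ n * D)"] by simp
qed

lemma degree_S_poly: "degree (S_poly (Suc n)) = 2 * n + 1"
proof -
  obtain C where C: "C \<noteq> 0"
    "pderiv (S_poly (Suc n)) = smult C ([:0, 1:] ^ n * [:- 1, 1:] ^ n)"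
    by (rule pderiv_S_poly)
  then have "pderiv (S_poly (Suc n)) \<noteq> 0" by simp
  then have "degree (S_poly (Suc n)) \<noteq> 0" by (simp add: pderiv_eq_0_iff)
  moreover have "degree (pderiv (S_poly (Suc n))) = 2 * n"
    unfolding C(2) using C(1) by (subst degree_smult_eq, subst degree_mult_eq)
      (auto simp: degree_linear_power degree_power_eq)
  ultimately show ?thesis by (simp add: degree_pderiv)
qed

lemma order_pderiv_S_poly:
  "order z (pderiv (S_poly (Suc n))) = (if z \<in> {0, 1} then n else 0)"
proof -
  obtain C where "C \<noteq> 0"
    "pderiv (S_poly (Suc n)) = smult C ([:0, 1:] ^ n * [:- 1, 1:] ^ n)"
    by (rule pderiv_S_poly)
  then show ?thesis
    using order_linear_powers[of 0 1 z n] by (simp add: order_smult)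
qed

section \<open>The outer polynomial\<close>

text \<open>The centre of the equilateral triangle whose corners are the roots of \<open>T_poly\<close>.\<close>

definition centre :: complex where
  "centre = Complex (1 / 2) (- sqrt 3 / 6)"

text \<open>The leading coefficient of \<open>T_poly\<close>.\<close>

definition lead :: complex where
  "lead = Complex 0 (3 * sqrt 3)"

lemma centre_quadratic: "centre - centre ^ 2 = 1 / 3"
  by (simp add: centre_def complex_eq_iff power2_eq_square field_simps)

lemma lead_centre: "lead * centre ^ 3 = 1"
  by (simp add: lead_def centre_def complex_eq_iff power3_eq_cube field_simps)

lemma lead_nonzero [simp]: "lead \<noteq> 0"
  and centre_nonzero [simp]: "centre \<noteq> 0"
  by (simp_all add: lead_def centre_def complex_eq_iff)

lemma poly_T_poly: "poly T_poly z = 1 + lead * (z - centre) ^ 3"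
proof -
  have eqs: "lead = 3 * \<i> * complex_of_real (sqrt 3)"
    "centre = 1 / 2 - \<i> * complex_of_real (sqrt 3) / 6"
    by (simp_all add: lead_def centre_def complex_eq_iff)
  have identity: "- 108 * s * ((j + s - 2 * j * z) * (z - 1) * z)
      = 72 + j * s * (6 * z - 3 + j * s) ^ 3"
    if "s ^ 2 = 3" "j ^ 2 = - 1" for s j :: complex
  proof -
    \<comment> \<open>Both sides depend on \<open>s\<close> and \<open>j\<close> only through the square root \<open>j * s\<close> of \<open>- 3\<close>.\<close>
    define t where "t = j * s"
    have "t ^ 2 = - 3" using that by (simp add: t_def power_mult_distrib)
    then have "- 108 * ((t + 3 - 2 * t * z) * (z - 1) * z) = 72 + t * (6 * z - 3 + t) ^ 3"
      by algebra
    moreover have "s * (j + s - 2 * j * z) = t + 3 - 2 * t * z"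
      using that by (simp add: t_def algebra_simps power2_eq_square)
    moreover have "- 108 * s * ((j + s - 2 * j * z) * (z - 1) * z)
        = - 108 * ((s * (j + s - 2 * j * z)) * (z - 1) * z)" by simp
    ultimately show ?thesis by (simp only: t_def)
  qed
  have "complex_of_real (sqrt 3) ^ 2 = 3"
    by (simp flip: of_real_power)
  note identity = identity[OF this power2_i]
  have cube: "(z - (1 / 2 - x / 6)) ^ 3 = (6 * z - 3 + x) ^ 3 / 216" for x :: complex
  proof -
    have *: "z - (1 / 2 - x / 6) = (6 * z - 3 + x) / 6" by (simp add: field_simps)
    show ?thesis unfolding * by (simp add: power_divide)
  qed
  have "72 * poly T_poly z
      = - 108 * complex_of_real (sqrt 3) * ((\<i> + complex_of_real (sqrt 3) - 2 * \<i> * z) * (z - 1) * z)"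
    by (simp add: T_poly_def field_simps)
  also have "\<dots> = 72 * (1 + lead * (z - centre) ^ 3)"
    unfolding identity eqs cube by simp
  finally show ?thesis unfolding mult_cancel_left by simp
qed

section \<open>The composition\<close>

lemma poly_composition:
  "poly (pcompose T_poly (S_poly r)) z = 1 + lead * (poly (S_poly r) z - centre) ^ 3"
  by (simp add: poly_pcompose poly_T_poly)

lemma composition_eq:
  "pcompose T_poly (S_poly r) = 1 + smult lead ((S_poly r - [:centre:]) ^ 3)"
  by (intro poly_eq_poly_eq_iff[THEN iffD1] ext) (simp add: poly_composition)

context
  fixes n :: nat and F :: "complex poly"
  defines "F \<equiv> pcompose T_poly (S_poly (Suc n))"
begin

lemma shifted_S_nonzero: "S_poly (Suc n) - [:centre:] \<noteq> 0"
  using degree_S_poly[of n] by auto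

lemma degree_composition: "degree F = 6 * n + 3"
proof -
  have "degree (S_poly (Suc n) - [:centre:]) = 2 * n + 1"
    using degree_S_poly[of n] degree_add_eq_left[of "- [:centre:]" "S_poly (Suc n)"]
    unfolding diff_conv_add_uminus by simp
  then have "degree (smult lead ((S_poly (Suc n) - [:centre:]) ^ 3)) = 6 * n + 3"
    using degree_power_eq[OF shifted_S_nonzero, of 3] by simp
  then show ?thesis
    unfolding F_def composition_eq by (subst degree_add_eq_right) auto
qed

lemma pderiv_composition:
  "pderiv F = smult (3 * lead) ((S_poly (Suc n) - [:centre:]) ^ 2 * pderiv (S_poly (Suc n)))"
  unfolding F_def composition_eq
  by (simp add: pderiv_add pderiv_smult pderiv_power pderiv_diff pderiv_pCons mult.commute)

lemma order_pderiv_composition: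
  "order z (pderiv F) =
     2 * order z (S_poly (Suc n) - [:centre:]) + (if z \<in> {0, 1} then n else 0)"
proof -
  have "pderiv F \<noteq> 0" using degree_composition by (simp add: pderiv_eq_0_iff)
  then show ?thesis
    unfolding pderiv_composition order_pderiv_S_poly[symmetric]
    by (simp add: order_smult order_mult order_power shifted_S_nonzero)
qed

lemma composition_at_0_1: "poly F 0 = 0" "poly F 1 = 0"
proof -
  have "(1 - centre) ^ 3 = - (centre ^ 3)"
    using centre_quadratic by algebra
  then show "poly F 0 = 0"
    using lead_centre by (simp add: F_def poly_composition)
  show "poly F 1 = 0"
    using lead_centre by (simp add: F_def poly_composition)
qed

lemma composition_eq_1_iff: "poly F z = 1 \<longleftrightarrow> poly (S_poly (Suc n)) z = centre"
  by (simp add: F_def poly_composition)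

lemma order_composition_black:
  assumes "poly F z = 0"
  shows "order z F = (if z \<in> {0, 1} then Suc n else 1)"
proof -
  have "order z (S_poly (Suc n) - [:centre:]) = 0"
    using assms composition_eq_1_iff[of z] by (intro order_0I) auto
  moreover have "order z F = Suc (order z (pderiv F))"
    using assms degree_composition by (intro order_pderiv) auto
  ultimately show ?thesis by (simp add: order_pderiv_composition)
qed

lemma order_composition_white:
  assumes "poly F z = 1"
  shows "order z (F - 1) = 3"
proof -
  have z: "z \<notin> {0, 1}" using assms composition_at_0_1 by auto
  have "order z (S_poly (Suc n) - [:centre:])
      = Suc (order z (pderiv (S_poly (Suc n) - [:centre:])))"
    using assms shifted_S_nonzero by (intro order_pderiv) (auto simp: composition_eq_1_iff)
  then have "order z (S_poly (Suc n) - [:centre:]) = 1"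
    using z by (simp add: pderiv_diff pderiv_pCons order_pderiv_S_poly)
  moreover have "order z (F - 1) = Suc (order z (pderiv (F - 1)))"
    using assms degree_composition by (intro order_pderiv) auto
  ultimately show ?thesis using z by (simp add: pderiv_diff order_pderiv_composition)
qed

lemma shabat_composition: "shabat F"
  unfolding shabat_def
proof (intro conjI allI impI)
  show "degree F > 0" by (simp add: degree_composition)
  fix z assume "poly (pderiv F) z = 0"
  then have "order z (pderiv F) \<noteq> 0"
    using degree_composition order_root[of "pderiv F" z] by (auto simp: pderiv_eq_0_iff)
  then have "z \<in> {0, 1} \<or> order z (S_poly (Suc n) - [:centre:]) \<noteq> 0"
    by (auto simp: order_pderiv_composition split: if_splits)
  then show "poly F z \<in> {0, 1}"
    using composition_at_0_1 order_root[of "S_poly (Suc n) - [:centre:]" z]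
    by (auto simp: composition_eq_1_iff)
qed

lemma passport_composition:
  "passport (shabat_tree F) =
     (replicate_mset 2 (Suc n) + replicate_mset (4 * n + 1) 1, replicate_mset (2 * n + 1) 3)"
proof -
  define A where "A = {z. poly F z = 0} - {0, 1}"
  define W where "W = {z. poly F z = 1}"
  have nz: "F \<noteq> 0" "F - 1 \<noteq> 0" using degree_composition by auto
  have fin: "finite A" unfolding A_def using poly_roots_finite[OF nz(1)] by simp
  have black: "{z. poly F z = 0} = {0, 1} \<union> A"
    using composition_at_0_1 by (auto simp: A_def)
  have sum_split: "(\<Sum>z | poly F z = 0. f z) = f 0 + f 1 + (\<Sum>z\<in>A. f z)"
    for f :: "complex \<Rightarrow> nat"
    unfolding black using fin by (subst sum.union_disjoint) (auto simp: A_def)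
  have on_A: "order z F = 1" if "z \<in> A" for z
    using that order_composition_black[of z] by (auto simp: A_def)
  have on_01: "order 0 F = Suc n" "order 1 F = Suc n"
    using order_composition_black composition_at_0_1 by auto
  \<comment> \<open>Counting roots with multiplicity: \<open>2 * (n + 1) + card A = 6 * n + 3\<close>.\<close>
  have "card A = 4 * n + 1"
    using sum_order_eq_degree[OF nz(1)] sum_split[of "\<lambda>z. order z F"] on_A on_01
    by (simp add: degree_composition)
  moreover have "mset_set {z. poly F z = 0} = {#0, 1#} + mset_set A"
    unfolding black using fin by (subst mset_set_Union) (auto simp: A_def)
  ultimately have 1: "image_mset (\<lambda>z. order z F) (mset_set {z. poly F z = 0}) =
      replicate_mset 2 (Suc n) + replicate_mset (4 * n + 1) 1"
    using image_mset_const_on[OF on_A, of A] on_01 by (simp add: numeral_2_eq_2)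
  have W_roots: "W = {z. poly (F - 1) z = 0}" by (auto simp: W_def)
  have on_W: "order z (F - 1) = 3" if "z \<in> W" for z
    using that order_composition_white by (simp add: W_def)
  have "degree (F - 1) = 6 * n + 3"
    using degree_add_eq_left[of "- 1" F] by (simp add: degree_composition)
  then have "3 * card W = 6 * n + 3"
    using sum_order_eq_degree[OF nz(2)] on_W unfolding W_roots[symmetric] by simp
  then have "card W = 2 * n + 1" by simp
  then have 2: "image_mset (\<lambda>z. order z (F - 1)) (mset_set W) = replicate_mset (2 * n + 1) 3"
    using image_mset_const_on[OF on_W, of W] by simp
  show ?thesis by (simp only: passport_shabat_tree 1 2[unfolded W_def])
qed

end

section \<open>Uniqueness\<close>

text \<open>The shape that the passport forces on a polynomial: a constant plus a multiple of a cube, and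
  two distinct zeros at which the derivative of the base of the cube vanishes to order \<open>n\<close>.\<close>

lemma passport_shape:
  fixes G :: "complex poly"
  assumes deg: "degree G > 0"
    and pp: "passport (shabat_tree G) =
      (replicate_mset 2 (Suc n) + replicate_mset m 1, replicate_mset (2 * n + 1) 3)"
  obtains c P a b where "G = 1 + smult c (P ^ 3)" "c \<noteq> 0" "degree P = 2 * n + 1" "a \<noteq> b"
    "poly G a = 0" "poly G b = 0" "order a (pderiv P) = n" "order b (pderiv P) = n"
proof -
  define W where "W = {z. poly G z = 1}"
  have nz: "G \<noteq> 0" "G - 1 \<noteq> 0" using deg by auto
  have W_roots: "W = {z. poly (G - 1) z = 0}" by (auto simp: W_def)
  have finW: "finite W" unfolding W_roots using nz(2) by (rule poly_roots_finite)
  have white: "image_mset (\<lambda>z. order z (G - 1)) (mset_set W) = replicate_mset (2 * n + 1) 3"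
    using pp by (simp add: passport_shabat_tree W_def)
  have on_W: "order z (G - 1) = 3" if "z \<in> W" for z
  proof -
    have "order z (G - 1) \<in># image_mset (\<lambda>z. order z (G - 1)) (mset_set W)"
      using that finW by auto
    then show ?thesis unfolding white by (simp split: if_splits)
  qed
  have card_W: "card W = 2 * n + 1"
    using arg_cong[OF white, of size] by simp
  define P where "P = (\<Prod>z\<in>W. [:- z, 1:])"
  define c where "c = lead_coeff (G - 1)"
  have "c \<noteq> 0" using nz(2) unfolding c_def leading_coeff_0_iff .
  have "G - 1 = smult c (\<Prod>z\<in>W. [:- z, 1:] ^ order z (G - 1))"
    unfolding c_def W_roots by (rule complex_poly_decompose[symmetric])
  also have "(\<Prod>z\<in>W. [:- z, 1:] ^ order z (G - 1)) = P ^ 3"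
    unfolding P_def prod_power_distrib by (intro prod.cong) (auto simp: on_W)
  finally have G: "G = 1 + smult c (P ^ 3)" by (simp add: algebra_simps)
  have degP: "degree P = 2 * n + 1"
    unfolding P_def by (subst degree_prod_sum_eq) (auto simp: card_W)
  have nzP: "P \<noteq> 0" "pderiv P \<noteq> 0" using degP by (auto simp: pderiv_eq_0_iff)
  have dG: "pderiv G = smult (3 * c) (P ^ 2 * pderiv P)"
    unfolding G by (simp add: pderiv_add pderiv_smult pderiv_power mult.commute)
  have ord: "order z (pderiv P) = n" if "poly G z = 0" "order z G = Suc n" for z
  proof -
    have "order z P = 0" using that(1) by (intro order_0I) (auto simp: G)
    moreover have "order z G = Suc (order z (pderiv G))"
      using that nz by (intro order_pderiv) auto
    ultimately show ?thesis
      using that \<open>c \<noteq> 0\<close> nzP by (simp add: dG order_smult order_mult order_power)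
  qed
  have "image_mset (\<lambda>z. order z G) (mset_set {z. poly G z = 0})
      = replicate_mset 2 (Suc n) + replicate_mset m 1"
    using pp by (simp add: passport_shabat_tree)
  from arg_cong[OF this, of "\<lambda>M. count M (Suc n)"]
  have "card {z \<in> {z. poly G z = 0}. order z G = Suc n} \<ge> 2"
    using poly_roots_finite[OF nz(1)] by (simp add: count_image_mset_set)
  then obtain a b where "a \<noteq> b" "poly G a = 0" "poly G b = 0" "order a G = Suc n" "order b G = Suc n"
    by (rule two_elements_if_card_ge_2) auto
  then show thesis using that[OF G \<open>c \<noteq> 0\<close> degP] ord by blast
qed

text \<open>A polynomial of the degree of \<open>S_poly (Suc n)\<close> whose derivative vanishes to order \<open>n\<close> at two
  points is \<open>S_poly (Suc n)\<close> up to affine maps on both sides: the derivatives are proportional after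
  the substitution. The values at the two points differ, since otherwise the polynomial would be
  constant.\<close>

lemma affine_S_poly:
  fixes a b :: complex
  assumes "a \<noteq> b" "degree P = 2 * n + 1" "order a (pderiv P) = n" "order b (pderiv P) = n"
  shows "poly P a \<noteq> poly P b"
    and "poly P (a + (b - a) * z) = (poly P a - poly P b) * poly (S_poly (Suc n)) z + poly P b"
proof -
  define S where "S = S_poly (Suc n)"
  obtain k where k: "k \<noteq> 0" "pderiv P = smult k ([:- a, 1:] ^ n * [:- b, 1:] ^ n)"
    using pderiv_eq_linear_powers[OF assms] .
  obtain C where C: "C \<noteq> 0" "pderiv S = smult C ([:0, 1:] ^ n * [:- 1, 1:] ^ n)"
    unfolding S_def by (rule pderiv_S_poly)
  \<comment> \<open>Each of the \<open>2 * n\<close> linear factors and the chain rule contribute one factor \<open>b - a\<close>.\<close>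
  define q where "q = k * (b - a) ^ (2 * n + 1) / C"
  define D where "D = pcompose P [:a, b - a:] - smult q S"
  have "pderiv D = 0"
  proof (intro poly_eq_poly_eq_iff[THEN iffD1] ext)
    fix x
    have "(b - a) * x + a - b = (b - a) * (x - 1)" by (simp add: algebra_simps)
    then have "poly (pderiv (pcompose P [:a, b - a:])) x
        = k * (((b - a) * x) ^ n * ((b - a) * (x - 1)) ^ n) * (b - a)"
      by (simp add: pderiv_pcompose poly_pcompose k(2) pderiv_pCons algebra_simps)
    also have "\<dots> = q * poly (pderiv S) x"
      using C by (simp add: q_def power_mult_distrib mult_2 power_add)
    finally show "poly (pderiv D) x = poly 0 x"
      by (simp add: D_def pderiv_diff pderiv_smult)
  qed
  then obtain d where d: "D = [:d:]" using pderiv_iszero by blast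
  have P: "poly P (a + (b - a) * x) = q * poly S x + d" for x
  proof -
    have "poly D x = d" using d by simp
    then show ?thesis by (simp add: D_def poly_pcompose algebra_simps)
  qed
  have "poly P a = q + d" "poly P b = d" using P[of 0] P[of 1] by (simp_all add: S_def)
  moreover have "q \<noteq> 0" using k C assms by (simp add: q_def)
  ultimately show "poly P a \<noteq> poly P b"
    and "poly P (a + (b - a) * z) = (poly P a - poly P b) * poly (S_poly (Suc n)) z + poly P b"
    using P[of z] by (simp_all add: S_def)
qed

text \<open>Distinct numbers with equal cubes are two corners of an equilateral triangle centred at the
  origin. The alternatives say that the similarity taking \<open>1, 0\<close> to \<open>u, v\<close>, or the one taking them
  to \<open>v, u\<close>, maps \<open>centre\<close> to the origin; which one does depends on the orientation.\<close>

lemma equal_cubes_cases: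
  fixes u v :: complex
  assumes "u ^ 3 = v ^ 3" "u \<noteq> v"
  shows "v = - centre * (u - v) \<or> u = - centre * (v - u)"
proof -
  have "(u - v) * (u ^ 2 + u * v + v ^ 2) = 0"
    using assms(1) by (simp add: algebra_simps power2_eq_square power3_eq_cube)
  then have *: "u ^ 2 + u * v + v ^ 2 = 0" using assms(2) by simp
  have "(v + centre * (u - v)) * (u + centre * (v - u))
      = u * v + (centre - centre ^ 2) * (u - v) ^ 2"
    by (simp add: algebra_simps power2_eq_square)
  also have "\<dots> = (u ^ 2 + u * v + v ^ 2) / 3"
    unfolding centre_quadratic by (simp add: field_simps power2_eq_square)
  finally have "(v + centre * (u - v)) * (u + centre * (v - u)) = 0"
    using * by simp
  then show ?thesis by (auto simp: eq_neg_iff_add_eq_0)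
qed

text \<open>The hypothesis on the values at \<open>a\<close> and \<open>b\<close> is the first alternative above. It makes
  \<open>(u - v) S + v\<close>, with \<open>u = P(a)\<close> and \<open>v = P(b)\<close>, the multiple \<open>(u - v) (S - centre)\<close> of the
  polynomial whose cube occurs in the composition.\<close>

lemma isomorphic_if_oriented:
  fixes a b :: complex
  assumes G: "G = 1 + smult c (P ^ 3)" and "a \<noteq> b" and deg: "degree P = 2 * n + 1"
    and ord: "order a (pderiv P) = n" "order b (pderiv P) = n"
    and root: "poly G b = 0"
    and oriented: "poly P b = - centre * (poly P a - poly P b)"
  shows "shabat_isomorphic G (pcompose T_poly (S_poly (Suc n)))"
  unfolding shabat_isomorphic_def
proof (intro exI allI)
  fix z
  let ?d = "poly P a - poly P b"
  \<comment> \<open>The value \<open>0\<close> at \<open>b\<close> fixes the remaining constant, by \<open>lead_centre\<close>.\<close>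
  have "c * (poly P b) ^ 3 = - 1" using root by (simp add: G add_eq_0_iff)
  then have "c * (- centre * ?d) ^ 3 = - 1" by (simp only: flip: oriented)
  then have "(c * ?d ^ 3) * centre ^ 3 = lead * centre ^ 3"
    unfolding lead_centre by (simp add: power_mult_distrib mult_ac)
  then have c: "c * ?d ^ 3 = lead" by simp
  define x where "x = (z - a) / (b - a)"
  have "poly P z = poly P (a + (b - a) * x)" using \<open>a \<noteq> b\<close> by (simp add: x_def)
  also have "\<dots> = ?d * poly (S_poly (Suc n)) x + poly P b"
    using affine_S_poly(2)[OF \<open>a \<noteq> b\<close> deg ord] .
  also have "\<dots> = ?d * (poly (S_poly (Suc n)) x - centre)"
    using oriented by (simp add: algebra_simps)
  finally have "poly G z = 1 + (c * ?d ^ 3) * (poly (S_poly (Suc n)) x - centre) ^ 3"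
    by (simp add: G power_mult_distrib)
  also have "\<dots> = poly (pcompose T_poly (S_poly (Suc n))) x"
    unfolding c poly_composition ..
  also have "x = inverse (b - a) * z + (- a / (b - a))"
    by (simp add: x_def divide_inverse algebra_simps)
  finally show "poly G z = poly (pcompose T_poly (S_poly (Suc n)))
      (inverse (b - a) * z + (- a / (b - a)))" .
qed

lemma passport_unique:
  assumes "degree G > 0"
    and "passport (shabat_tree G) =
      (replicate_mset 2 (Suc n) + replicate_mset m 1, replicate_mset (2 * n + 1) 3)"
  shows "shabat_isomorphic G (pcompose T_poly (S_poly (Suc n)))"
proof -
  obtain c P a b where G: "G = 1 + smult c (P ^ 3)" and "c \<noteq> 0" and deg: "degree P = 2 * n + 1"
    and "a \<noteq> b" and roots: "poly G a = 0" "poly G b = 0"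
    and ord: "order a (pderiv P) = n" "order b (pderiv P) = n"
    using passport_shape[OF assms] by metis
  have "c * (poly P a) ^ 3 = c * (poly P b) ^ 3"
    using roots unfolding G by (simp add: add_eq_0_iff)
  then have "(poly P a) ^ 3 = (poly P b) ^ 3" using \<open>c \<noteq> 0\<close> by simp
  moreover have "poly P a \<noteq> poly P b" by (rule affine_S_poly(1)[OF \<open>a \<noteq> b\<close> deg ord])
  ultimately consider "poly P b = - centre * (poly P a - poly P b)"
    | "poly P a = - centre * (poly P b - poly P a)"
    using equal_cubes_cases by blast
  then show ?thesis
  proof cases
    case 1
    then show ?thesis
      using isomorphic_if_oriented[OF G \<open>a \<noteq> b\<close> deg ord roots(2)] by blast
  next
    case 2
    then show ?thesis
      using isomorphic_if_oriented[OF G \<open>a \<noteq> b\<close>[symmetric] deg ord(2,1) roots(1)] by blast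
  qed
qed

section \<open>Existence and uniqueness\<close>

theorem proposition4:
  fixes r :: nat and F :: "complex poly"
    and pp :: "nat multiset \<times> nat multiset"
  assumes "r \<ge> 1"
  defines "F \<equiv> pcompose T_poly (S_poly r)"
    and "pp \<equiv> (replicate_mset 2 r + replicate_mset (4 * r - 3) 1, replicate_mset (2 * r - 1) 3)"
  shows "shabat F \<and>
    passport (shabat_tree F) = pp \<and>
    {0, 1} \<subseteq> black_vertices (shabat_tree F) \<and>
    black_degree (shabat_tree F) 0 = r \<and>
    black_degree (shabat_tree F) 1 = r \<and>
    (\<forall>G. shabat G \<and> passport (shabat_tree G) = pp \<longrightarrow> shabat_isomorphic G F)"
proof -
  obtain n where r: "r = Suc n" using assms(1) by (cases r) auto
  have pp: "pp = (replicate_mset 2 (Suc n) + replicate_mset (4 * n + 1) 1, replicate_mset (2 * n + 1) 3)"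
    by (simp add: pp_def r)
  note zeros = composition_at_0_1[of n, folded r, folded F_def]
  note orders = order_composition_black[of n, folded r, folded F_def, OF zeros(1)]
    order_composition_black[of n, folded r, folded F_def, OF zeros(2)]
  have "shabat_isomorphic G F" if "shabat G" "passport (shabat_tree G) = pp" for G
    using passport_unique[of G n "4 * n + 1"] that unfolding pp by (simp add: shabat_def F_def r)
  moreover have "shabat F" unfolding F_def r by (rule shabat_composition)
  moreover have "passport (shabat_tree F) = pp"
    unfolding F_def pp unfolding r by (rule passport_composition)
  ultimately show ?thesis
    using zeros orders by (simp add: shabat_tree_def)
qed

end
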